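(* Let $X$ be a non-negative and absolutely continuous random variable with cumulative distribution function $F$ and let $\breve L_{\alpha}$ be its $\alpha$-generalized reversed aging intensity function with $\alpha<0$. Then $F$ and $\breve L_{\alpha}$ are related, for all $a\in(0,+\infty)$, by the relationship $$F(x)=\left[1-(1-F^{\alpha}(a))\exp\left(-\int_a^x \frac{\breve L_{\alpha}(t)}{t}\,\mathrm dt \right)\right]^{\frac{1}{\alpha}},\qquad x\in(0,+\infty).$$ Moreover, a function $\breve L$ defined on $(0,+\infty)$ and satisfying, for $a\in(0,+\infty)$, the following conditions: (1) $0\le \breve L(x)<+\infty$, for all $x\in(0,+\infty)$; (2) $\lim_{x\to0^+}\int_x^a \frac{\breve L(t)}{t}\,\mathrm dt=+\infty$; (3) $\lim_{x\to+\infty}\int_a^x \frac{\breve L(t)}{t}\,\mathrm dt=+\infty$; determines, for $\alpha<0$, a family of absolutely continuous distribution functions $F_k$ by the relationship $$F_k(x)=1-W_\alpha\left(k\exp\left(-\int_a^x \frac{\breve L(t)}{t}\,\mathrm dt\right)\right)=\left[1-k\alpha\exp\left(-\int_a^x \frac{\breve L(t)}{t}\,\mathrm dt \right)\right]^{\frac{1}{\alpha}},\qquad x\in(0,+\infty),$$ for varying the parameter $k\in(0,+\infty)$, and $\breve L$ is the $\alpha$-generalized reversed aging intensity function for those distribution functions.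
   Context: For a non-negative and absolutely continuous random variable with cumulative distribution function $F$ and probability density function $f$, and for a real number $\alpha\neq 0$, the $\alpha$-generalized reversed aging intensity function of the variable (or of its distribution function $F$) is $$\breve L_\alpha(x)=\frac{\alpha x F^{\alpha-1}(x) f(x)}{1-F^\alpha(x)},\qquad x>0,$$ where $F^\alpha(x)$ means $(F(x))^\alpha$. For $\alpha<0$, $W_\alpha$ denotes the generalized Pareto distribution function with parameter $\alpha$, given by $W_\alpha(x)=1-(1-\alpha x)^{1/\alpha}$ for $x>0$. For $x<a$, $\int_a^x$ means $-\int_x^a$.
   Formalization: The first formula is stated for a, x > 0 with 0<F(a)<1 and 0<F(x)<1 (it fails, e.g., for X uniform on [1,2], a=3); in the second part L(t)/t is explicitly assumed Lebesgue integrable between a and every x>0, so that the integrals are finite. *)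

theory Defs
  imports "HOL-Probability.Probability"
begin

(* F is the distribution function and f a (version of the) density. A density is determined by F
   only up to null sets, so f is passed explicitly.
   The quotient is meaningful only where 0 < F x < 1; elsewhere the value is a HOL default. *)
definition gen_rev_aging_intensity ::
    "real \<Rightarrow> (real \<Rightarrow> real) \<Rightarrow> (real \<Rightarrow> real) \<Rightarrow> real \<Rightarrow> real" where
  "gen_rev_aging_intensity \<alpha> F f x = \<alpha> * x * F x powr (\<alpha> - 1) * f x / (1 - F x powr \<alpha>)"

(* Intended for \<alpha> < 0; the support is then the whole half-line (0, \<infinity>). *)
definition gen_pareto :: "real \<Rightarrow> real \<Rightarrow> real" where
  "gen_pareto \<alpha> x = (if 0 < x then 1 - (1 - \<alpha> * x) powr (1 / \<alpha>) else 0)"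

definition abs_cont_cdf :: "(real \<Rightarrow> real) \<Rightarrow> (real \<Rightarrow> real) \<Rightarrow> bool" where
  "abs_cont_cdf F f \<longleftrightarrow>
     f \<in> borel_measurable borel \<and> (\<forall>x. 0 \<le> f x) \<and>
     prob_space (density lborel (\<lambda>x. ennreal (f x))) \<and>
     F = cdf (density lborel (\<lambda>x. ennreal (f x)))"

(* The family F_k, extended by 0 to the nonpositive reals (distributions on the half-line).
   The interval integral LBINT t=a..x is oriented: for x < a it is the negative of LBINT t=x..a. *)
definition pareto_family ::
    "real \<Rightarrow> (real \<Rightarrow> real) \<Rightarrow> real \<Rightarrow> real \<Rightarrow> real \<Rightarrow> real" where
  "pareto_family \<alpha> L a k x =
     (if 0 < x then 1 - gen_pareto \<alpha> (k * exp (- (LBINT t=a..x. L t / t))) else 0)"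

end

theory Submission
  imports Defs
begin

text \<open>
  Both halves rest on one chain rule. Let \<open>I\<close> be continuous and nondecreasing with
  \<open>I t - I s = \<mu> {s<..t}\<close> for a measure \<open>\<mu>\<close> with density \<open>h\<close>. If \<open>G\<close> has derivative
  \<open>g \<ge> 0\<close>, then \<open>g (I t) h t\<close> integrates over \<open>{a<..b}\<close> to \<open>G (I b) - G (I a)\<close>. Since \<open>h\<close>
  is merely measurable, \<open>I\<close> may fail to be differentiable on a null set, so the fundamental theorem
  of calculus does not apply to \<open>G \<circ> I\<close> directly. Instead, \<open>I\<close> transports \<open>\<mu>\<close> on \<open>{a<..b}\<close> to
  Lebesgue measure on \<open>{I a<..I b}\<close> (the probability integral transform,
  \<open>distr_distribution_function\<close>), and the fundamental theorem is applied to \<open>G\<close> alone.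

  For the representation of \<open>F\<close>, take \<open>I = F\<close>, \<open>h = f\<close> and \<open>G u = - ln (u powr \<alpha> - 1)\<close>, so that
  \<open>g (F t) f t\<close> is the intensity divided by \<open>t\<close>. Exponentiating
  \<open>\<integral> L/t = ln (F a powr \<alpha> - 1) - ln (F x powr \<alpha> - 1)\<close> and solving for \<open>F x\<close> gives the formula.

  For the converse, take \<open>h t = L t / t\<close> on the positive reals, \<open>I x\<close> the oriented integral of \<open>h\<close>
  from \<open>a\<close> to \<open>x\<close>, and \<open>H u = (1 - k \<alpha> exp (- u)) powr (1 / \<alpha>)\<close>, which increases from 0 at
  \<open>-\<infinity>\<close> to 1 at \<open>+\<infinity>\<close>. By the chain rule \<open>H' (I t) h t\<close> has mass \<open>H (I t) - H (I s)\<close> on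
  \<open>{s<..t}\<close>. The two divergence conditions say that \<open>I\<close> runs from \<open>-\<infinity>\<close> to \<open>+\<infinity>\<close>, which makes
  this a probability density with distribution function \<open>H \<circ> I\<close> (\<open>abs_cont_cdf_compose\<close>). That
  \<open>L\<close> is its intensity is then an algebraic identity valid at every point.
\<close>

section \<open>The chain rule for a distribution function\<close>

text \<open>
  Measures on the line are compared on the half-lines \<open>{u<..}\<close>. For \<open>u\<close> between \<open>I a\<close> and \<open>I b\<close>
  the set where \<open>I > u\<close> is \<open>{s<..b}\<close>, with \<open>s\<close> the last point at which \<open>I\<close> takes the value \<open>u\<close>;
  its measure is \<open>I b - u\<close>.
\<close>

lemma distr_distribution_function:
  fixes \<mu> :: "real measure" and I :: "real \<Rightarrow> real"
  assumes sets: "sets \<mu> = sets borel" and "a \<le> b"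
    and cont: "continuous_on {a..b} I" and mono: "mono_on {a..b} I"
    and meas: "\<And>s t. a \<le> s \<Longrightarrow> s \<le> t \<Longrightarrow> t \<le> b \<Longrightarrow> emeasure \<mu> {s<..t} = ennreal (I t - I s)"
  shows "distr (restrict_space \<mu> {a<..b}) borel I = density lborel (indicator {I a<..I b})"
proof (rule measure_eqI_lessThan)
  note [measurable_cong] = sets
  have "I \<in> borel_measurable (restrict_space borel {a<..b})"
    by (rule borel_measurable_continuous_on_restrict) (rule continuous_on_subset[OF cont], auto)
  then have [measurable]: "I \<in> borel_measurable (restrict_space \<mu> {a<..b})"
    using sets by (simp cong: measurable_cong_sets sets_restrict_space_cong)
  have space: "space \<mu> = UNIV" using sets_eq_imp_space_eq[OF sets] by simp
  have left: "emeasure (distr (restrict_space \<mu> {a<..b}) borel I) {u<..}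
      = emeasure \<mu> {t\<in>{a<..b}. u < I t}" for u
    by (subst emeasure_distr)
       (auto simp: space_restrict_space space sets emeasure_restrict_space intro!: arg_cong2[where f=emeasure])
  have right: "emeasure (density lborel (indicator {I a<..I b})) {u<..} = ennreal (I b - max u (I a))" for u
  proof -
    have "emeasure (density lborel (indicator {I a<..I b})) {u<..} = emeasure lborel ({I a<..I b} \<inter> {u<..})"
      by (subst emeasure_density) (auto simp flip: indicator_inter_arith)
    also have "{I a<..I b} \<inter> {u<..} = {max u (I a)<..I b}" by auto
    finally show ?thesis
      by (cases "max u (I a) \<le> I b") (auto simp: ennreal_neg max_def split: if_splits)
  qed
  have eq: "emeasure \<mu> {t\<in>{a<..b}. u < I t} = ennreal (I b - max u (I a))" for u
  proof -
    consider "u < I a" | "I b \<le> u" | "I a \<le> u" "u < I b" by linarith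
    then show ?thesis
    proof cases
      case 1
      have "u < I t" if "t \<in> {a<..b}" for t
        using 1 mono_onD[OF mono, of a t] that by auto
      then have "{t\<in>{a<..b}. u < I t} = {a<..b}" by blast
      with 1 show ?thesis using meas[of a b] \<open>a \<le> b\<close> by simp
    next
      case 2
      then have "I t \<le> u" if "t \<in> {a<..b}" for t
        using mono_onD[OF mono, of t b] that by auto
      then have "{t\<in>{a<..b}. u < I t} = {}" using leD by blast
      with 2 show ?thesis by (simp only:) (simp add: ennreal_neg)
    next
      case 3
      let ?S = "{t\<in>{a..b}. I t = u}"
      have "closed ?S" by (rule continuous_closed_preimage_constant[OF cont]) simp
      moreover have "bounded ?S" by (rule bounded_subset[OF bounded_closed_interval[of a b]]) auto
      ultimately have "compact ?S" by (simp add: compact_eq_bounded_closed)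
      moreover have "?S \<noteq> {}"
        using IVT'[of I a u b] 3 cont \<open>a \<le> b\<close> by auto
      \<comment> \<open>\<open>I\<close> may be constant on an interval, hence the last solution of \<open>I s = u\<close> is chosen.\<close>
      ultimately obtain s where s: "s \<in> ?S" and max: "\<And>t. t \<in> ?S \<Longrightarrow> t \<le> s"
        using compact_attains_sup[of ?S] by auto
      have "u < I t \<longleftrightarrow> s < t" if "t \<in> {a<..b}" for t
      proof
        show "s < t" if "u < I t"
        proof (rule ccontr)
          assume "\<not> s < t"
          then have "I t \<le> I s" using mono s \<open>t \<in> {a<..b}\<close> by (auto simp: mono_on_def)
          then show False using s that by auto
        qed
        show "u < I t" if "s < t"
        proof -
          have "I s \<le> I t" using mono s \<open>t \<in> {a<..b}\<close> that by (auto simp: mono_on_def)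
          moreover have "I t \<noteq> u" using max[of t] that \<open>t \<in> {a<..b}\<close> by auto
          ultimately show ?thesis using s by auto
        qed
      qed
      then have "{t\<in>{a<..b}. u < I t} = {s<..b}" using s by auto
      with s 3 show ?thesis using meas[of s b] by (simp only:) (auto simp: max_def)
    qed
  qed
  show "emeasure (distr (restrict_space \<mu> {a<..b}) borel I) {u<..} < \<infinity>" for u
    by (simp only: left eq) simp
  show "emeasure (distr (restrict_space \<mu> {a<..b}) borel I) {u<..}
      = emeasure (density lborel (indicator {I a<..I b})) {u<..}" for u
    by (simp only: left eq right)
qed auto

lemma nn_integral_substitution_distribution_function:
  fixes \<mu> :: "real measure" and I g G :: "real \<Rightarrow> real"
  assumes sets: "sets \<mu> = sets borel" and "a \<le> b"
    and cont: "continuous_on {a..b} I" and mono: "mono_on {a..b} I"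
    and meas: "\<And>s t. a \<le> s \<Longrightarrow> s \<le> t \<Longrightarrow> t \<le> b \<Longrightarrow> emeasure \<mu> {s<..t} = ennreal (I t - I s)"
    and g[measurable]: "g \<in> borel_measurable borel"
    and deriv: "\<And>u. I a \<le> u \<Longrightarrow> u \<le> I b \<Longrightarrow> (G has_real_derivative g u) (at u)"
    and nonneg: "\<And>u. I a \<le> u \<Longrightarrow> u \<le> I b \<Longrightarrow> 0 \<le> g u"
  shows "(\<integral>\<^sup>+t. ennreal (g (I t)) * indicator {a<..b} t \<partial>\<mu>) = ennreal (G (I b) - G (I a))"
proof -
  have Iab: "I a \<le> I b" using mono \<open>a \<le> b\<close> by (auto simp: mono_on_def)
  have "I \<in> borel_measurable (restrict_space borel {a<..b})"
    by (rule borel_measurable_continuous_on_restrict) (rule continuous_on_subset[OF cont], auto)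
  then have [measurable]: "I \<in> borel_measurable (restrict_space \<mu> {a<..b})"
    using sets by (simp cong: measurable_cong_sets sets_restrict_space_cong)
  have "(\<integral>\<^sup>+t. ennreal (g (I t)) * indicator {a<..b} t \<partial>\<mu>)
      = (\<integral>\<^sup>+t. ennreal (g (I t)) \<partial>restrict_space \<mu> {a<..b})"
    by (rule nn_integral_restrict_space[symmetric]) (simp add: sets)
  also have "\<dots> = (\<integral>\<^sup>+u. ennreal (g u) \<partial>distr (restrict_space \<mu> {a<..b}) borel I)"
    by (rule nn_integral_distr[symmetric]) auto
  also have "\<dots> = (\<integral>\<^sup>+u. ennreal (g u) * indicator {I a<..I b} u \<partial>lborel)"
    by (subst distr_distribution_function[OF sets \<open>a \<le> b\<close> cont mono meas])
       (auto simp: nn_integral_density mult.commute)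
  also have "\<dots> = (\<integral>\<^sup>+u. ennreal (g u) * indicator {I a..I b} u \<partial>lborel)"
    by (intro nn_integral_cong_AE, rule AE_mp[OF AE_lborel_singleton[of "I a"]])
       (auto split: split_indicator)
  also have "\<dots> = ennreal (G (I b) - G (I a))"
    using deriv nonneg Iab by (intro nn_integral_FTC_Icc) (auto intro: has_real_derivative_iff_has_vector_derivative[THEN iffD1])
  finally show ?thesis .
qed

text \<open>
  The nonnegative integral is the previous lemma; being finite, it also yields integrability and
  the value of the Bochner integral.
\<close>

lemma chain_rule_density:
  fixes h I g G :: "real \<Rightarrow> real"
  assumes h[measurable]: "h \<in> borel_measurable borel" and h_nonneg: "\<And>t. 0 \<le> h t" and "a \<le> b"
    and cont: "continuous_on {a..b} I" and mono: "mono_on {a..b} I"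
    and meas: "\<And>s t. a \<le> s \<Longrightarrow> s \<le> t \<Longrightarrow> t \<le> b \<Longrightarrow>
        emeasure (density lborel (\<lambda>x. ennreal (h x))) {s<..t} = ennreal (I t - I s)"
    and g[measurable]: "g \<in> borel_measurable borel"
    and deriv: "\<And>u. I a \<le> u \<Longrightarrow> u \<le> I b \<Longrightarrow> (G has_real_derivative g u) (at u)"
    and g_nonneg: "\<And>u. I a \<le> u \<Longrightarrow> u \<le> I b \<Longrightarrow> 0 \<le> g u"
  shows nn_integral_chain_rule_density:
      "(\<integral>\<^sup>+t. ennreal (g (I t) * h t) * indicator {a<..b} t \<partial>lborel) = ennreal (G (I b) - G (I a))" (is ?nn)
    and set_integrable_chain_rule_density: "set_integrable lborel {a<..b} (\<lambda>t. g (I t) * h t)" (is ?int)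
    and set_integral_chain_rule_density:
      "(LINT t:{a<..b}|lborel. g (I t) * h t) = G (I b) - G (I a)" (is ?eq)
proof -
  have Iab: "I a \<le> I b" using mono \<open>a \<le> b\<close> by (auto simp: mono_on_def)
  have range: "I a \<le> I t \<and> I t \<le> I b" if "t \<in> {a<..b}" for t
    using mono_onD[OF mono, of a t] mono_onD[OF mono, of t b] that by auto
  have "I \<in> borel_measurable (restrict_space borel {a<..b})"
    by (rule borel_measurable_continuous_on_restrict) (rule continuous_on_subset[OF cont], auto)
  then have "(\<lambda>t. g (I t)) \<in> borel_measurable (restrict_space borel {a<..b})"
    by simp
  then have gI[measurable]: "(\<lambda>t. indicator {a<..b} t * g (I t)) \<in> borel_measurable borel"
    by (subst (asm) borel_measurable_restrict_space_iff) auto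
  have gI'[measurable]: "(\<lambda>t. ennreal (g (I t)) * indicator {a<..b} t) \<in> borel_measurable borel"
  proof -
    have "(\<lambda>t. ennreal (indicator {a<..b} t * g (I t))) \<in> borel_measurable borel" by measurable
    then show ?thesis
      by (rule measurable_cong[THEN iffD1, rotated]) (auto split: split_indicator)
  qed
  have "(\<integral>\<^sup>+t. ennreal (g (I t) * h t) * indicator {a<..b} t \<partial>lborel)
      = (\<integral>\<^sup>+t. ennreal (h t) * (ennreal (g (I t)) * indicator {a<..b} t) \<partial>lborel)"
    using range g_nonneg h_nonneg
    by (intro nn_integral_cong) (auto simp: ennreal_mult mult.commute split: split_indicator)
  also have "\<dots> = (\<integral>\<^sup>+t. ennreal (g (I t)) * indicator {a<..b} t \<partial>density lborel (\<lambda>x. ennreal (h x)))"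
    by (subst nn_integral_density) auto
  also have "\<dots> = ennreal (G (I b) - G (I a))"
    by (rule nn_integral_substitution_distribution_function[OF _ \<open>a \<le> b\<close> cont mono meas g deriv g_nonneg])
       auto
  finally show nn: ?nn .
  have G: "0 \<le> G (I b) - G (I a)"
    using DERIV_nonneg_imp_nondecreasing[OF Iab, of G] deriv g_nonneg by fastforce
  have "has_bochner_integral lborel (\<lambda>t. indicator {a<..b} t *\<^sub>R (g (I t) * h t)) (G (I b) - G (I a))"
  proof (rule has_bochner_integral_nn_integral)
    have "(\<lambda>t. (indicator {a<..b} t * g (I t)) * h t) \<in> borel_measurable lborel" by measurable
    then show "(\<lambda>t. indicator {a<..b} t *\<^sub>R (g (I t) * h t)) \<in> borel_measurable lborel"
      by (simp add: mult.assoc)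
    show "AE t in lborel. 0 \<le> indicator {a<..b} t *\<^sub>R (g (I t) * h t)"
      using range g_nonneg h_nonneg by (intro AE_I2) (auto split: split_indicator)
    show "(\<integral>\<^sup>+t. ennreal (indicator {a<..b} t *\<^sub>R (g (I t) * h t)) \<partial>lborel) = ennreal (G (I b) - G (I a))"
      unfolding nn[symmetric] by (intro nn_integral_cong) (auto split: split_indicator)
  qed (rule G)
  then show ?int ?eq
    by (auto simp: set_integrable_def set_lebesgue_integral_def has_bochner_integral_iff)
qed

section \<open>A distribution function is determined by its intensity\<close>

text \<open>
  The antiderivative is \<open>G u = - ln (u powr \<alpha> - 1)\<close>. It is defined and increasing on the range of
  \<open>F\<close> over \<open>{c..d}\<close> because that range stays inside \<open>{0<..<1}\<close>, where \<open>u powr \<alpha> > 1\<close>.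
\<close>

lemma gen_rev_aging_intensity_integral:
  fixes F f :: "real \<Rightarrow> real"
  assumes "\<alpha> < 0" "abs_cont_cdf F f" "0 < c" "c \<le> d" "0 < F c" "F d < 1"
  shows "interval_lebesgue_integrable lborel (ereal c) (ereal d) (\<lambda>t. gen_rev_aging_intensity \<alpha> F f t / t)"
    and "(LBINT t=c..d. gen_rev_aging_intensity \<alpha> F f t / t)
      = ln (F c powr \<alpha> - 1) - ln (F d powr \<alpha> - 1)"
proof -
  define N where "N = density lborel (\<lambda>x. ennreal (f x))"
  have f[measurable]: "f \<in> borel_measurable borel" and f_nonneg: "\<And>x. 0 \<le> f x"
    and "prob_space N" and F: "F = cdf N"
    using \<open>abs_cont_cdf F f\<close> by (auto simp: abs_cont_cdf_def N_def)
  interpret prob_space N by fact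
  interpret finite_borel_measure N by unfold_locales (simp add: N_def)
  (* A measure with a density has no atoms, so its distribution function is continuous. *)
  have "emeasure N {x} = 0" for x
    by (auto simp: N_def emeasure_density nn_integral_indicator_singleton)
  then have "isCont F x" for x
    unfolding F isCont_cdf by (simp add: measure_def)
  then have cont: "continuous_on {c..d} F"
    by (auto intro: continuous_at_imp_continuous_on)
  have mono: "mono_on {c..d} F"
    by (auto simp: mono_on_def F cdf_nondecreasing)
  have meas: "emeasure N {s<..t} = ennreal (F t - F s)" if "s \<le> t" for s t
    using that cdf_diff_eq[of s t] by (cases "s = t") (auto simp: F emeasure_eq_measure)
  let ?g = "\<lambda>u. \<alpha> * u powr (\<alpha> - 1) / (1 - u powr \<alpha>)"
  let ?G = "\<lambda>u. - ln (u powr \<alpha> - 1)"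
  have gt1: "1 < u powr \<alpha>" if "F c \<le> u" "u \<le> F d" for u
    using that assms powr_less_mono2_neg[of \<alpha> u 1] by auto
  have deriv: "(?G has_real_derivative ?g u) (at u)" if "F c \<le> u" "u \<le> F d" for u
  proof -
    have "0 < u" "u powr \<alpha> > 1" using that assms gt1 by auto
    then show ?thesis
      by (auto intro!: derivative_eq_intros simp: field_simps)
  qed
  have g_nonneg: "0 \<le> ?g u" if "F c \<le> u" "u \<le> F d" for u
    using gt1[OF that] \<open>\<alpha> < 0\<close> by (intro divide_nonpos_nonpos) (auto intro: mult_nonpos_nonneg)
  note chain = chain_rule_density[where g="?g" and G="?G",
      OF f f_nonneg \<open>c \<le> d\<close> cont mono meas[unfolded N_def] _ deriv g_nonneg]
  have eq: "gen_rev_aging_intensity \<alpha> F f t / t = ?g (F t) * f t" if "t \<in> {c<..d}" for t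
    using that \<open>0 < c\<close> by (simp add: gen_rev_aging_intensity_def)
  have "set_integrable lborel {c<..d} (\<lambda>t. ?g (F t) * f t)"
    by (rule chain(2)) auto
  then have "set_integrable lborel {c<..d} (\<lambda>t. gen_rev_aging_intensity \<alpha> F f t / t)"
    using eq by (subst set_integrable_cong[OF refl refl]) auto
  then show "interval_lebesgue_integrable lborel (ereal c) (ereal d) (\<lambda>t. gen_rev_aging_intensity \<alpha> F f t / t)"
    using \<open>c \<le> d\<close> by (auto simp: interval_lebesgue_integrable_def intro: set_integrable_subset)
  have "(LBINT t=c..d. gen_rev_aging_intensity \<alpha> F f t / t)
      = (LINT t:{c<..d}|lborel. ?g (F t) * f t)"
    unfolding interval_integral_Ioc[OF \<open>c \<le> d\<close>]
    using eq by (intro set_lebesgue_integral_cong) auto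
  also have "\<dots> = ?G (F d) - ?G (F c)"
    by (rule chain(3)) auto
  finally show "(LBINT t=c..d. gen_rev_aging_intensity \<alpha> F f t / t)
      = ln (F c powr \<alpha> - 1) - ln (F d powr \<alpha> - 1)" by simp
qed

lemma cdf_eq_gen_rev_aging_intensity:
  fixes F f :: "real \<Rightarrow> real"
  assumes "\<alpha> < 0" and F: "abs_cont_cdf F f" and "0 < a" "0 < x"
    and Fa: "0 < F a" "F a < 1" and Fx: "0 < F x" "F x < 1"
  shows "interval_lebesgue_integrable lborel (ereal a) (ereal x) (\<lambda>t. gen_rev_aging_intensity \<alpha> F f t / t)"
    and "F x = (1 - (1 - F a powr \<alpha>) *
      exp (- (LBINT t=a..x. gen_rev_aging_intensity \<alpha> F f t / t))) powr (1 / \<alpha>)"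
proof -
  let ?L = "\<lambda>t. gen_rev_aging_intensity \<alpha> F f t / t"
  have *: "interval_lebesgue_integrable lborel (ereal a) (ereal x) ?L \<and>
      (LBINT t=a..x. ?L t) = ln (F a powr \<alpha> - 1) - ln (F x powr \<alpha> - 1)"
  proof (cases "a \<le> x")
    case True
    then show ?thesis
      using gen_rev_aging_intensity_integral[OF \<open>\<alpha> < 0\<close> F] assms by auto
  next
    case False
    then show ?thesis
      using gen_rev_aging_intensity_integral[OF \<open>\<alpha> < 0\<close> F, of x a] assms
      by (simp add: interval_integrable_endpoints_reverse[of "ereal a"]
          interval_integral_endpoints_reverse[of "ereal a"])
  qed
  then show "interval_lebesgue_integrable lborel (ereal a) (ereal x) ?L" by blast
  have gt1: "1 < u powr \<alpha>" if "0 < u" "u < 1" for u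
    using that \<open>\<alpha> < 0\<close> powr_less_mono2_neg[of \<alpha> u 1] by auto
  have "exp (- (LBINT t=a..x. ?L t)) = (F x powr \<alpha> - 1) / (F a powr \<alpha> - 1)"
    using * gt1[OF Fa] gt1[OF Fx] by (simp add: exp_diff)
  then have "1 - (1 - F a powr \<alpha>) * exp (- (LBINT t=a..x. ?L t)) = F x powr \<alpha>"
    using gt1[OF Fa] by (simp add: field_simps)
  then show "F x = (1 - (1 - F a powr \<alpha>) * exp (- (LBINT t=a..x. ?L t))) powr (1 / \<alpha>)"
    using \<open>\<alpha> < 0\<close> Fx by (simp add: powr_powr)
qed

lemma abs_cont_cdf_distr:
  assumes "prob_space M" and nonneg: "\<And>x. 0 \<le> f x"
    and X: "distributed M lborel X (\<lambda>x. ennreal (f x))"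
  shows "abs_cont_cdf (cdf (distr M lborel X)) f"
proof -
  interpret prob_space M by fact
  have "X \<in> measurable M lborel" using X by (rule distributed_measurable)
  then have "prob_space (distr M lborel X)" by (rule prob_space_distr)
  moreover have "f \<in> borel_measurable borel"
    using distributed_real_measurable[OF _ X] nonneg by simp
  ultimately show ?thesis
    using nonneg distributed_distr_eq_density[OF X] by (simp add: abs_cont_cdf_def)
qed

section \<open>Distribution functions built from a divergent primitive\<close>

text \<open>
  The chain rule applies on \<open>{s<..t}\<close> for \<open>s > 0\<close> only, because \<open>I\<close> tends to \<open>-\<infinity>\<close> at 0. Letting
  \<open>s\<close> tend to 0 and then \<open>t\<close> to infinity, continuity of measure from below gives mass \<open>H (I t)\<close>
  to \<open>{..t}\<close> and total mass 1.
\<close>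

lemma abs_cont_cdf_compose:
  fixes H g I h :: "real \<Rightarrow> real"
  assumes h[measurable]: "h \<in> borel_measurable borel" and h_nonneg: "\<And>t. 0 \<le> h t"
    and cont: "continuous_on {0<..} I" and mono: "mono_on {0<..} I"
    and meas: "\<And>s t. 0 < s \<Longrightarrow> s \<le> t \<Longrightarrow>
        emeasure (density lborel (\<lambda>x. ennreal (h x))) {s<..t} = ennreal (I t - I s)"
    and g[measurable]: "g \<in> borel_measurable borel"
    and deriv: "\<And>u. (H has_real_derivative g u) (at u)" and g_nonneg: "\<And>u. 0 \<le> g u"
    and I_bot: "filterlim I at_bot (at_right 0)" and I_top: "filterlim I at_top at_top"
    and H_bot: "(H \<longlongrightarrow> 0) at_bot" and H_top: "(H \<longlongrightarrow> 1) at_top"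
  shows "abs_cont_cdf (\<lambda>x. if 0 < x then H (I x) else 0) (\<lambda>x. if 0 < x then g (I x) * h x else 0)"
proof -
  let ?f = "\<lambda>x. if 0 < x then g (I x) * h x else 0"
  have "I \<in> borel_measurable (restrict_space borel {0<..})"
    by (rule borel_measurable_continuous_on_restrict[OF cont])
  then have "(\<lambda>t. g (I t)) \<in> borel_measurable (restrict_space borel {0<..})"
    by simp
  then have gI[measurable]: "(\<lambda>t. indicator {0<..} t * g (I t)) \<in> borel_measurable borel"
    by (subst (asm) borel_measurable_restrict_space_iff) auto
  have "(\<lambda>t. (indicator {0<..} t * g (I t)) * h t) \<in> borel_measurable borel" by measurable
  moreover have "(\<lambda>t. (indicator {0<..} t * g (I t)) * h t) = ?f" by (auto split: split_indicator)
  ultimately have f[measurable]: "?f \<in> borel_measurable borel" by simp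
  have f_nonneg: "0 \<le> ?f x" for x using g_nonneg h_nonneg by auto
  define D where "D = density lborel (\<lambda>x. ennreal (?f x))"
  have sets_D[simp]: "sets D = sets borel" by (simp add: D_def)
  have Ioc: "emeasure D {s<..t} = ennreal (H (I t) - H (I s))" if "0 < s" "s \<le> t" for s t
  proof -
    have "emeasure D {s<..t} = (\<integral>\<^sup>+x. ennreal (g (I x) * h x) * indicator {s<..t} x \<partial>lborel)"
      unfolding D_def using \<open>0 < s\<close>
      by (subst emeasure_density) (auto intro!: nn_integral_cong split: split_indicator)
    also have "\<dots> = ennreal (H (I t) - H (I s))"
      using that
      by (intro nn_integral_chain_rule_density h h_nonneg g deriv g_nonneg meas
          continuous_on_subset[OF cont] mono_on_subset[OF mono]) auto
    finally show ?thesis .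
  qed
  have Iic_pos: "emeasure D {..t} = ennreal (H (I t))" if "0 < t" for t
  proof -
    define s where "s n = t / real (Suc n)" for n
    have s: "0 < s n" "s n \<le> t" for n
      using \<open>0 < t\<close> by (auto simp: s_def field_simps)
    have "s \<longlonglongrightarrow> 0"
      unfolding s_def by (rule LIMSEQ_Suc[OF lim_const_over_n])
    have "filterlim s (at_right 0) sequentially"
      using \<open>s \<longlonglongrightarrow> 0\<close> s(1) by (simp add: filterlim_at less_imp_neq[symmetric])
    then have "(\<lambda>n. H (I (s n))) \<longlonglongrightarrow> 0"
      by (intro filterlim_compose[OF H_bot] filterlim_compose[OF I_bot])
    then have "(\<lambda>n. ennreal (H (I t) - H (I (s n)))) \<longlonglongrightarrow> ennreal (H (I t) - 0)"
      by (intro tendsto_ennrealI tendsto_intros)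
    then have "(\<lambda>n. emeasure D {s n<..t}) \<longlonglongrightarrow> ennreal (H (I t))"
      using s by (simp add: Ioc)
    moreover have "(\<lambda>n. emeasure D {s n<..t}) \<longlonglongrightarrow> emeasure D (\<Union>n. {s n<..t})"
    proof (rule Lim_emeasure_incseq)
      have "s n \<le> s m" if "m \<le> n" for m n
        using that \<open>0 < t\<close> by (auto simp: s_def intro!: divide_left_mono)
      then show "incseq (\<lambda>n. {s n<..t})"
        by (fastforce simp: incseq_def)
    qed auto
    moreover have "(\<Union>n. {s n<..t}) = {0<..t}"
    proof -
      have "\<exists>n. s n < x" if "0 < x" for x
        using order_tendstoD(2)[OF \<open>s \<longlonglongrightarrow> 0\<close> that] by (auto simp: eventually_sequentially)
      moreover have "0 < x" if "s n < x" for n x using s(1)[of n] that by linarith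
      ultimately show ?thesis by auto
    qed
    ultimately have "emeasure D {0<..t} = ennreal (H (I t))"
      by (simp add: LIMSEQ_unique)
    moreover have "emeasure D {..t} = emeasure D {0<..t}"
      unfolding D_def by (subst (1 2) emeasure_density)
        (auto intro!: nn_integral_cong split: split_indicator)
    ultimately show ?thesis by simp
  qed
  have Iic_nonpos: "emeasure D {..t} = 0" if "t \<le> 0" for t
    unfolding D_def using that by (subst emeasure_density)
      (auto simp: nn_integral_0_iff_AE split: split_indicator)
  have "(\<lambda>n. emeasure D {..real (Suc n)}) \<longlonglongrightarrow> emeasure D (\<Union>n. {..real (Suc n)})"
    by (rule Lim_emeasure_incseq) (auto simp: incseq_def)
  moreover have "(\<Union>n. {..real (Suc n)}) = UNIV"
  proof -
    have "\<exists>n. x \<le> real (Suc n)" for x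
    proof -
      obtain n where "x \<le> real n" using real_arch_simple by blast
      then show ?thesis by (intro exI[of _ n]) simp
    qed
    then show ?thesis by auto
  qed
  moreover have "filterlim (\<lambda>n. real (Suc n)) at_top sequentially"
    by (rule filterlim_compose[OF filterlim_real_sequentially filterlim_Suc])
  then have "(\<lambda>n. H (I (real (Suc n)))) \<longlonglongrightarrow> 1"
    by (intro filterlim_compose[OF H_top] filterlim_compose[OF I_top])
  then have "(\<lambda>n. ennreal (H (I (real (Suc n))))) \<longlonglongrightarrow> ennreal 1"
    by (rule tendsto_ennrealI)
  then have "(\<lambda>n. emeasure D {..real (Suc n)}) \<longlonglongrightarrow> 1"
    by (simp add: Iic_pos)
  ultimately have "emeasure D UNIV = 1"
    by (simp add: LIMSEQ_unique)
  then have "prob_space D" by (intro prob_spaceI) (simp add: D_def)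
  moreover have "(\<lambda>x. if 0 < x then H (I x) else 0) = cdf D"
  proof
    fix x
    have "0 \<le> H u" for u
    proof (rule tendsto_upperbound[OF H_bot])
      have "H v \<le> H u" if "v \<le> u" for v
        by (rule DERIV_nonneg_imp_nondecreasing[OF that]) (use deriv g_nonneg in blast)
      then show "\<forall>\<^sub>F v in at_bot. H v \<le> H u" by (auto simp: eventually_at_bot_linorder)
    qed auto
    then show "(if 0 < x then H (I x) else 0) = cdf D x"
      using Iic_pos[of x] Iic_nonpos[of x] by (auto simp: cdf_def measure_def)
  qed
  ultimately show ?thesis
    using f f_nonneg by (simp add: abs_cont_cdf_def D_def)
qed

text \<open>
  A nonnegative \<open>\<phi>\<close> that is integrable between the base point \<open>a\<close> and every other positive point
  supplies the pair \<open>h\<close>, \<open>I\<close> of the previous lemma, apart from the limits of \<open>I\<close>: its extension by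
  zero is the density \<open>h\<close> and its oriented integral from \<open>a\<close> is the function \<open>I\<close>.
\<close>

context
  fixes \<phi> :: "real \<Rightarrow> real" and a :: real
  assumes a: "0 < a" and \<phi>_nonneg: "\<And>t. 0 < t \<Longrightarrow> 0 \<le> \<phi> t"
    and int_a: "\<And>x. 0 < x \<Longrightarrow> interval_lebesgue_integrable lborel (ereal a) (ereal x) \<phi>"
begin

lemma set_integrable_Icc_pos:
  assumes "0 < s"
  shows "set_integrable lborel {s..t} \<phi>"
proof (cases "s \<le> t")
  case True
  have "set_integrable lborel {min a x<..<max a x} \<phi>" if "0 < x" for x
    using int_a[OF that] by (cases "a \<le> x") (auto simp: interval_lebesgue_integrable_def max_def min_def)
  moreover have "set_integrable lborel {x} \<phi>" for x
  proof -
    have "(\<lambda>t. indicator {x} t *\<^sub>R \<phi> t) = (\<lambda>t. indicator {x} t * \<phi> x)"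
      by (auto split: split_indicator)
    then show ?thesis by (simp add: set_integrable_def)
  qed
  (* The open intervals between a and s and between a and t cover {s..t} up to the points a, s, t. *)
  ultimately have "set_integrable lborel
      ({min a s<..<max a s} \<union> {min a t<..<max a t} \<union> {a} \<union> {s} \<union> {t}) \<phi>"
    using assms True by (intro set_integrable_Un) auto
  then show ?thesis
    by (rule set_integrable_subset) (auto simp: min_def max_def)
qed (simp add: set_integrable_def)

text \<open>
  Integrability on compact intervals includes measurability there, and the zero extension is the
  pointwise limit of the restrictions to \<open>{1/(n+1)..n}\<close>.
\<close>

lemma borel_measurable_zero_extension: "(\<lambda>t. if 0 < t then \<phi> t else 0) \<in> borel_measurable borel"
proof (rule borel_measurable_LIMSEQ_real)
  fix n :: nat
  show "(\<lambda>t. indicator {1 / real (Suc n)..real n} t *\<^sub>R \<phi> t) \<in> borel_measurable borel"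
    using set_integrable_Icc_pos[of "1 / real (Suc n)" "real n"]
    by (auto simp: set_integrable_def dest: borel_measurable_integrable)
next
  fix t :: real
  show "(\<lambda>n. indicator {1 / real (Suc n)..real n} t *\<^sub>R \<phi> t) \<longlonglongrightarrow> (if 0 < t then \<phi> t else 0)"
  proof (cases "0 < t")
    case True
    have "\<forall>\<^sub>F n in sequentially. 1 / real (Suc n) < t"
      using order_tendstoD(2)[OF LIMSEQ_Suc[OF lim_1_over_n] True] by simp
    moreover have "\<forall>\<^sub>F n in sequentially. t \<le> real n"
      using filterlim_real_sequentially by (auto simp: filterlim_at_top)
    ultimately have "\<forall>\<^sub>F n in sequentially. indicator {1 / real (Suc n)..real n} t *\<^sub>R \<phi> t = \<phi> t"
      by eventually_elim simp
    then show ?thesis using True by (simp add: tendsto_eventually)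
  next
    case False
    have "\<not> 1 / real (Suc n) \<le> t" for n
    proof -
      have "0 < 1 / real (Suc n)" by simp
      with False show ?thesis by linarith
    qed
    with False show ?thesis by simp
  qed
qed

lemma primitive_diff_eq_set_integral:
  assumes "0 < s" "s \<le> t"
  shows "(LBINT u=a..t. \<phi> u) - (LBINT u=a..s. \<phi> u) = (LINT u:{s..t}|lborel. \<phi> u)"
proof -
  have "interval_lebesgue_integrable lborel (ereal x) (ereal y) \<phi>" if "0 < x" "x \<le> y" for x y
    using set_integrable_Icc_pos[of x y] that
    by (auto simp: interval_lebesgue_integrable_def intro: set_integrable_subset)
  then have "(LBINT u=a..s. \<phi> u) + (LBINT u=s..t. \<phi> u) = (LBINT u=a..t. \<phi> u)"
    using assms a by (intro interval_integral_sum) (auto simp: min_def max_def)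
  then show ?thesis using assms by (simp add: interval_integral_Icc)
qed

lemma emeasure_Ioc_eq_primitive_diff:
  assumes "0 < s" "s \<le> t"
  shows "emeasure (density lborel (\<lambda>u. ennreal (if 0 < u then \<phi> u else 0))) {s<..t}
    = ennreal ((LBINT u=a..t. \<phi> u) - (LBINT u=a..s. \<phi> u))"
proof -
  let ?h = "\<lambda>u. if 0 < u then \<phi> u else 0"
  have [measurable]: "?h \<in> borel_measurable borel" by (rule borel_measurable_zero_extension)
  have "emeasure (density lborel (\<lambda>u. ennreal (?h u))) {s<..t}
      = (\<integral>\<^sup>+u. ennreal (?h u) * indicator {s<..t} u \<partial>lborel)"
    by (rule emeasure_density) measurable
  also have "\<dots> = (\<integral>\<^sup>+u. ennreal (indicator {s..t} u *\<^sub>R \<phi> u) \<partial>lborel)"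
  proof (rule nn_integral_cong_AE)
    show "AE u in lborel. ennreal (?h u) * indicator {s<..t} u = ennreal (indicator {s..t} u *\<^sub>R \<phi> u)"
      using AE_lborel_singleton[of s]
    proof eventually_elim
      case (elim u)
      then show ?case using \<open>0 < s\<close> by (auto simp: indicator_def)
    qed
  qed
  also have "\<dots> = ennreal (LINT u:{s..t}|lborel. \<phi> u)"
    unfolding set_lebesgue_integral_def
  proof (rule nn_integral_eq_integral)
    show "integrable lborel (\<lambda>u. indicator {s..t} u *\<^sub>R \<phi> u)"
      using set_integrable_Icc_pos[OF \<open>0 < s\<close>] by (simp add: set_integrable_def)
    show "AE u in lborel. 0 \<le> indicator {s..t} u *\<^sub>R \<phi> u"
      using \<open>0 < s\<close> \<phi>_nonneg by (intro AE_I2) (simp add: indicator_def)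
  qed
  finally show ?thesis
    using assms by (simp add: primitive_diff_eq_set_integral)
qed

lemma mono_on_primitive: "mono_on {0<..} (\<lambda>x::real. LBINT u=a..x. \<phi> u)"
proof (rule mono_onI)
  fix s t :: real
  assume "s \<in> {0<..}" "t \<in> {0<..}" "s \<le> t"
  moreover from this have "0 \<le> (LINT u:{s..t}|lborel. \<phi> u)"
    using \<phi>_nonneg unfolding set_lebesgue_integral_def
    by (intro integral_nonneg_AE AE_I2) (auto split: split_indicator)
  ultimately show "(LBINT u=a..s. \<phi> u) \<le> (LBINT u=a..t. \<phi> u)"
    using primitive_diff_eq_set_integral[of s t] by auto
qed

text \<open>
  On an interval \<open>{c..d}\<close> around a given point the oriented integral differs by a constant from
  the indefinite gauge integral from \<open>c\<close>, which is known to be continuous.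
\<close>

lemma continuous_on_primitive: "continuous_on {0<..} (\<lambda>x::real. LBINT u=a..x. \<phi> u)"
proof (rule continuous_at_imp_continuous_on, rule ballI)
  fix x :: real assume "x \<in> {0<..}"
  define c d where "c = x / 2" and "d = x + 1"
  have cd: "0 < c" "c < x" "x < d" using \<open>x \<in> {0<..}\<close> by (auto simp: c_def d_def)
  let ?J = "\<lambda>y. (LBINT u=a..c. \<phi> u) + integral {c..y} \<phi>"
  have "\<phi> integrable_on {c..d}"
    by (rule set_borel_integral_eq_integral(1)[OF set_integrable_Icc_pos[OF \<open>0 < c\<close>]])
  then have "continuous_on {c..d} ?J"
    by (intro continuous_on_add continuous_on_const indefinite_integral_continuous_1)
  moreover have "(LBINT u=a..y. \<phi> u) = ?J y" if "y \<in> {c..d}" for y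
  proof -
    have "c \<le> y" using that by simp
    then have "(LBINT u=a..y. \<phi> u) - (LBINT u=a..c. \<phi> u) = integral {c..y} \<phi>"
      unfolding primitive_diff_eq_set_integral[OF \<open>0 < c\<close> \<open>c \<le> y\<close>]
      by (intro set_borel_integral_eq_integral(2) set_integrable_Icc_pos \<open>0 < c\<close>)
    then show ?thesis by linarith
  qed
  ultimately have "continuous_on {c..d} (\<lambda>y. LBINT u=a..y. \<phi> u)"
    by (rule continuous_on_eq[OF _ sym])
  moreover have "x \<in> interior {c..d}" using cd by simp
  ultimately show "isCont (\<lambda>y::real. LBINT u=a..y. \<phi> u) x"
    by (rule continuous_on_interior)
qed

end

section \<open>The generalized Pareto family\<close>

lemma pareto_family_eq:
  assumes "0 < k" "0 < x"
  shows "pareto_family \<alpha> L a k x = 1 - gen_pareto \<alpha> (k * exp (- (LBINT t=a..x. L t / t)))"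
    and "pareto_family \<alpha> L a k x = (1 - k * \<alpha> * exp (- (LBINT t=a..x. L t / t))) powr (1 / \<alpha>)"
  using assms by (auto simp: pareto_family_def gen_pareto_def mult_ac)

text \<open>
  Since \<open>k * \<alpha> < 0\<close>, the base of the power exceeds 1 and decreases in \<open>u\<close> from infinity to 1; the
  negative exponent turns this into growth from 0 to 1.
\<close>

lemma pareto_profile:
  fixes \<alpha> k :: real
  defines "H \<equiv> \<lambda>u. (1 - k * \<alpha> * exp (- u)) powr (1 / \<alpha>)"
    and "g \<equiv> \<lambda>u. k * exp (- u) * (1 - k * \<alpha> * exp (- u)) powr (1 / \<alpha> - 1)"
  assumes "\<alpha> < 0" "0 < k"
  shows "(H has_real_derivative g u) (at u)" "(H \<longlongrightarrow> 0) at_bot" "(H \<longlongrightarrow> 1) at_top"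
proof -
  have k\<alpha>: "k * \<alpha> < 0" using assms by (simp add: mult_pos_neg)
  have pos: "0 < 1 - k * \<alpha> * exp (- u)" for u
    using mult_neg_pos[OF k\<alpha>, of "exp (- u)"] by simp
  have "((\<lambda>u. 1 - k * \<alpha> * exp (- u)) has_real_derivative k * \<alpha> * exp (- u)) (at u)"
    by (auto intro!: derivative_eq_intros)
  from DERIV_chain2[where f="\<lambda>z. z powr (1 / \<alpha>)" and g="\<lambda>u. 1 - k * \<alpha> * exp (- u)",
      OF has_real_derivative_powr[OF pos] this]
  show "(H has_real_derivative g u) (at u)"
    using \<open>\<alpha> < 0\<close> by (simp add: H_def g_def mult_ac)
  have exp_bot: "filterlim (\<lambda>u::real. exp (- u)) at_top at_bot"
    by (intro filterlim_compose[OF exp_at_top] filterlim_uminus_at_top_at_bot)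
  have "filterlim (\<lambda>u. 1 + (- (k * \<alpha>)) * exp (- u)) at_top at_bot"
    using k\<alpha> by (intro filterlim_tendsto_add_at_top[OF tendsto_const]
        filterlim_tendsto_pos_mult_at_top[OF tendsto_const _ exp_bot]) auto
  then have "filterlim (\<lambda>u. 1 - k * \<alpha> * exp (- u)) at_top at_bot"
    by simp
  then show "(H \<longlongrightarrow> 0) at_bot"
    unfolding H_def using \<open>\<alpha> < 0\<close> by (intro tendsto_neg_powr) (auto simp: divide_neg_pos)
  have "((\<lambda>u::real. exp (- u)) \<longlongrightarrow> 0) at_top"
    by (intro filterlim_compose[OF exp_at_bot] filterlim_uminus_at_bot_at_top)
  then have "((\<lambda>u. 1 - k * \<alpha> * exp (- u)) \<longlongrightarrow> 1 - k * \<alpha> * 0) at_top"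
    by (intro tendsto_intros)
  then have "(H \<longlongrightarrow> (1 - k * \<alpha> * 0) powr (1 / \<alpha>)) at_top"
    unfolding H_def by (intro tendsto_powr tendsto_const) auto
  then show "(H \<longlongrightarrow> 1) at_top" by simp
qed

text \<open>
  The density is taken to be \<open>H' (I x) * L x / x\<close> with the given \<open>L\<close>, so the intensity equals \<open>L\<close> at every
  positive point and not just almost everywhere. With \<open>B = F powr \<alpha>\<close> the powers of \<open>B\<close> in the
  numerator cancel and the denominator \<open>1 - B\<close> is \<open>k * \<alpha> * exp (- I x)\<close>.
\<close>

lemma pareto_family_intensity:
  fixes L :: "real \<Rightarrow> real"
  assumes "\<alpha> < 0" and a: "0 < a" and L: "\<And>x. 0 < x \<Longrightarrow> 0 \<le> L x"
    and int: "\<And>x. 0 < x \<Longrightarrow> interval_lebesgue_integrable lborel (ereal a) (ereal x) (\<lambda>t. L t / t)"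
    and zero: "filterlim (\<lambda>x::real. LBINT t=x..a. L t / t) at_top (at_right 0)"
    and inf: "filterlim (\<lambda>x::real. LBINT t=a..x. L t / t) at_top at_top"
    and "0 < k"
  shows "\<exists>f. abs_cont_cdf (pareto_family \<alpha> L a k) f \<and>
    (\<forall>x>0. L x = gen_rev_aging_intensity \<alpha> (pareto_family \<alpha> L a k) f x)"
proof -
  let ?I = "\<lambda>x::real. LBINT t=a..x. L t / t"
  let ?h = "\<lambda>t. if 0 < t then L t / t else 0"
  let ?B = "\<lambda>u. 1 - k * \<alpha> * exp (- u)"
  let ?H = "\<lambda>u. ?B u powr (1 / \<alpha>)"
  let ?g = "\<lambda>u. k * exp (- u) * ?B u powr (1 / \<alpha> - 1)"
  let ?f = "\<lambda>x. if 0 < x then ?g (?I x) * ?h x else 0"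
  have Lt: "0 \<le> L t / t" if "0 < t" for t using L[OF that] that by simp
  have "filterlim (\<lambda>x. - (LBINT t=ereal x..a. L t / t)) at_bot (at_right 0)"
    using zero by (simp add: filterlim_uminus_at_top)
  then have I_bot: "filterlim ?I at_bot (at_right 0)"
    by (subst interval_integral_endpoints_reverse)
  have "abs_cont_cdf (\<lambda>x. if 0 < x then ?H (?I x) else 0) ?f"
  proof (rule abs_cont_cdf_compose[where H="?H" and g="?g" and I="?I" and h="?h"])
    show "?h \<in> borel_measurable borel" by (rule borel_measurable_zero_extension[OF a Lt int])
    show "continuous_on {0<..} ?I" by (rule continuous_on_primitive[OF a Lt int])
    show "mono_on {0<..} ?I" by (rule mono_on_primitive[OF a Lt int])
    show "emeasure (density lborel (\<lambda>x. ennreal (?h x))) {s<..t} = ennreal (?I t - ?I s)"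
      if "0 < s" "s \<le> t" for s t by (rule emeasure_Ioc_eq_primitive_diff[OF a Lt int that])
    show "?g \<in> borel_measurable borel" by measurable
    show "(?H has_real_derivative ?g u) (at u)" for u
      by (rule pareto_profile[OF \<open>\<alpha> < 0\<close> \<open>0 < k\<close>])
    show "(?H \<longlongrightarrow> 0) at_bot" "(?H \<longlongrightarrow> 1) at_top"
      by (rule pareto_profile[OF \<open>\<alpha> < 0\<close> \<open>0 < k\<close>])+
    show "0 \<le> ?h t" for t using Lt by simp
    show "0 \<le> ?g u" for u using \<open>0 < k\<close> by simp
  qed (rule I_bot inf)+
  moreover have "pareto_family \<alpha> L a k = (\<lambda>x. if 0 < x then ?H (?I x) else 0)"
  proof
    fix x show "pareto_family \<alpha> L a k x = (if 0 < x then ?H (?I x) else 0)"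
      using pareto_family_eq(2)[OF \<open>0 < k\<close>, of x \<alpha> L a] by (cases "0 < x") (simp_all add: pareto_family_def)
  qed
  moreover have "L x = gen_rev_aging_intensity \<alpha> (\<lambda>x. if 0 < x then ?H (?I x) else 0) ?f x"
    if "0 < x" for x
  proof -
    define e B where "e = exp (- ?I x)" and "B = 1 - k * \<alpha> * e"
    have "0 < e" by (simp add: e_def)
    have k\<alpha>e: "k * \<alpha> * e < 0" using \<open>0 < k\<close> \<open>\<alpha> < 0\<close> \<open>0 < e\<close> by (simp add: mult_pos_neg mult_neg_pos)
    then have "0 < B" by (simp add: B_def)
    have F\<alpha>: "(B powr (1 / \<alpha>)) powr \<alpha> = B"
      using \<open>\<alpha> < 0\<close> \<open>0 < B\<close> by (simp add: powr_powr)
    have "(B powr (1 / \<alpha>)) powr (\<alpha> - 1) * B powr (1 / \<alpha> - 1) = 1"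
      using \<open>\<alpha> < 0\<close> \<open>0 < B\<close> by (simp add: powr_powr field_simps flip: powr_add)
    then have numerator: "\<alpha> * x * (B powr (1 / \<alpha>)) powr (\<alpha> - 1) * (k * e * B powr (1 / \<alpha> - 1) * (L x / x))
        = k * \<alpha> * e * L x"
      using that by (simp add: field_simps)
    have denominator: "1 - B = k * \<alpha> * e" by (simp add: B_def)
    have "gen_rev_aging_intensity \<alpha> (\<lambda>x. if 0 < x then ?H (?I x) else 0) ?f x
        = \<alpha> * x * (B powr (1 / \<alpha>)) powr (\<alpha> - 1) * (k * e * B powr (1 / \<alpha> - 1) * (L x / x)) / (1 - B)"
      unfolding gen_rev_aging_intensity_def by (simp only: that if_True F\<alpha> flip: e_def B_def)
    also have "\<dots> = L x"
      unfolding numerator denominator using k\<alpha>e by (intro nonzero_mult_div_cancel_left) auto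
    finally show ?thesis ..
  qed
  ultimately show ?thesis by (intro exI[of _ ?f]) simp
qed

theorem theorem3p1:
  fixes \<alpha> :: real
  assumes "\<alpha> < 0"
  shows
    "(\<forall>(M :: 'a measure) (X :: 'a \<Rightarrow> real) (f :: real \<Rightarrow> real) (F :: real \<Rightarrow> real).
        prob_space M \<and> (AE \<omega> in M. 0 \<le> X \<omega>) \<and>
        (\<forall>x. 0 \<le> f x) \<and> distributed M lborel X (\<lambda>x. ennreal (f x)) \<and>
        F = cdf (distr M lborel X) \<longrightarrow>
        (\<forall>a>0. \<forall>x>0. 0 < F a \<and> F a < 1 \<and> 0 < F x \<and> F x < 1 \<longrightarrow>
           interval_lebesgue_integrable lborel (ereal a) (ereal x)
             (\<lambda>t. gen_rev_aging_intensity \<alpha> F f t / t) \<and>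
           F x = (1 - (1 - F a powr \<alpha>) *
                    exp (- (LBINT t=a..x. gen_rev_aging_intensity \<alpha> F f t / t))) powr (1 / \<alpha>)))
     \<and>
     (\<forall>(L :: real \<Rightarrow> real) (a :: real).
        0 < a \<and>
        (\<forall>x>0. 0 \<le> L x) \<and>
        (\<forall>x>0. interval_lebesgue_integrable lborel (ereal a) (ereal x) (\<lambda>t. L t / t)) \<and>
        filterlim (\<lambda>x::real. LBINT t=x..a. L t / t) at_top (at_right 0) \<and>
        filterlim (\<lambda>x::real. LBINT t=a..x. L t / t) at_top at_top \<longrightarrow>
        (\<forall>k>0.
           (\<forall>x>0. pareto_family \<alpha> L a k x =
                    1 - gen_pareto \<alpha> (k * exp (- (LBINT t=a..x. L t / t))) \<and>
                  pareto_family \<alpha> L a k x =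
                    (1 - k * \<alpha> * exp (- (LBINT t=a..x. L t / t))) powr (1 / \<alpha>)) \<and>
           (\<exists>f. abs_cont_cdf (pareto_family \<alpha> L a k) f \<and>
                (\<forall>x>0. L x = gen_rev_aging_intensity \<alpha> (pareto_family \<alpha> L a k) f x))))"
proof (intro conjI allI impI; elim conjE)
  fix M :: "'a measure" and X :: "'a \<Rightarrow> real" and f F :: "real \<Rightarrow> real" and a x :: real
  assume "prob_space M" "\<forall>x. 0 \<le> f x" "distributed M lborel X (\<lambda>x. ennreal (f x))"
    "F = cdf (distr M lborel X)"
  then have F: "abs_cont_cdf F f" by (simp add: abs_cont_cdf_distr)
  assume "0 < a" "0 < x" "0 < F a" "F a < 1" "0 < F x" "F x < 1"
  from cdf_eq_gen_rev_aging_intensity[OF \<open>\<alpha> < 0\<close> F this]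
  show "interval_lebesgue_integrable lborel (ereal a) (ereal x) (\<lambda>t. gen_rev_aging_intensity \<alpha> F f t / t)"
    and "F x = (1 - (1 - F a powr \<alpha>) *
      exp (- (LBINT t=a..x. gen_rev_aging_intensity \<alpha> F f t / t))) powr (1 / \<alpha>)" .
next
  fix L :: "real \<Rightarrow> real" and a k x :: real
  assume "0 < k" "0 < x"
  then show "pareto_family \<alpha> L a k x = 1 - gen_pareto \<alpha> (k * exp (- (LBINT t=a..x. L t / t)))"
    and "pareto_family \<alpha> L a k x = (1 - k * \<alpha> * exp (- (LBINT t=a..x. L t / t))) powr (1 / \<alpha>)"
    by (rule pareto_family_eq)+
qed (simp add: pareto_family_intensity[OF \<open>\<alpha> < 0\<close>])

end
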